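(* Let $r>0$, let $\Omega=\{x\in\mathbb{R}^{N}:|x|>r\}$ be the exterior of the ball of radius $r$ centred at the origin, let $\delta(x)=\mathrm{dist}(x,\partial\Omega)=|x|-r$ for $x\in\Omega$, and let $p>N+2\gamma$. Then for all $u\in C_{0}^{\infty}(\Omega)$, $$\int_{\Omega}|\nabla_{k}u|^{p}\,d\mu_{k}\ \geq\ \left(\frac{p-N-2\gamma}{p}\right)^{p}\int_{\Omega}\frac{|u|^{p}}{\delta^{p}}\,d\mu_{k}.$$
   Context: Dunkl setting. $R\subset\mathbb{R}^{N}\setminus\{0\}$ is a root system: a finite set with $R\cap\mathbb{R}\alpha=\{-\alpha,\alpha\}$ and $\sigma_{\alpha}(R)=R$ for all $\alpha\in R$, where $\sigma_{\alpha}x=x-2\frac{\langle\alpha,x\rangle}{\langle\alpha,\alpha\rangle}\alpha$; it is normalized so that $|\alpha|^{2}=2$ for all $\alpha\in R$. $G$ is the finite group generated by the reflections $\sigma_{\alpha}$, $\alpha\in R$. $R_{+}$ is a fixed positive subsystem, so $R=R_{+}\cup(-R_{+})$ (disjoint union). $k:R\to[0,\infty)$, $\alpha\mapsto k_{\alpha}$, is a $G$-invariant function, and $\gamma:=\sum_{\alpha\in R_{+}}k_{\alpha}$. The Dunkl operators are $$T_{i}u(x)=\partial_{i}u(x)+\sum_{\alpha\in R_{+}}k_{\alpha}\alpha_{i}\frac{u(x)-u(\sigma_{\alpha}x)}{\langle\alpha,x\rangle},\qquad i=1,\dots,N,$$ and $\nabla_{k}=(T_{1},\dots,T_{N})$.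 The weighted measure is $d\mu_{k}=\omega_{k}(x)\,dx$ with $\omega_{k}(x)=\prod_{\alpha\in R_{+}}|\langle\alpha,x\rangle|^{2k_{\alpha}}$. Functions $u$ are real-valued. *)

theory Defs
  imports "HOL-Analysis.Analysis" "HOL-Algebra.Bij" "HOL-Algebra.Generated_Groups"
begin

section \<open>Root systems and reflection groups\<close>

definition reflection :: "real ^ 'n \<Rightarrow> real ^ 'n \<Rightarrow> real ^ 'n" where
  "reflection \<alpha> x = x - (2 * (\<alpha> \<bullet> x) / (\<alpha> \<bullet> \<alpha>)) *\<^sub>R \<alpha>"

definition root_system :: "(real ^ 'n) set \<Rightarrow> bool" where
  "root_system R \<longleftrightarrow> finite R \<and> 0 \<notin> R \<and>
     (\<forall>\<alpha>\<in>R. R \<inter> range (\<lambda>c::real. c *\<^sub>R \<alpha>) = {- \<alpha>, \<alpha>} \<and> reflection \<alpha> ` R = R)"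

definition normalized_roots :: "(real ^ 'n) set \<Rightarrow> bool" where
  "normalized_roots R \<longleftrightarrow> (\<forall>\<alpha>\<in>R. (norm \<alpha>)\<^sup>2 = 2)"

text \<open>Only the disjoint decomposition of \<open>R\<close> is required. In particular this covers the
  decompositions in which \<open>Rp\<close> and \<open>- Rp\<close> are separated by a hyperplane through the origin.\<close>

definition positive_subsystem :: "(real ^ 'n) set \<Rightarrow> (real ^ 'n) set \<Rightarrow> bool" where
  "positive_subsystem R Rp \<longleftrightarrow> R = Rp \<union> uminus ` Rp \<and> Rp \<inter> uminus ` Rp = {}"

definition reflection_group :: "(real ^ 'n) set \<Rightarrow> (real ^ 'n \<Rightarrow> real ^ 'n) set" where
  "reflection_group R = generate (BijGroup UNIV) (reflection ` R)"

lemma reflection_reflection: "reflection \<alpha> (reflection \<alpha> x) = x"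
  by (cases "\<alpha> = 0") (simp_all add: reflection_def inner_diff_right algebra_simps)

lemma reflection_in_BijGroup: "reflection ` (R :: (real ^ 'n) set) \<subseteq> carrier (BijGroup UNIV)"
proof -
  have "bij (reflection \<alpha> :: real ^ 'n \<Rightarrow> real ^ 'n)" for \<alpha>
    by (rule o_bij[where g = "reflection \<alpha>"]) (auto simp: reflection_reflection)
  then show ?thesis by (auto simp: BijGroup_def Bij_def)
qed

definition multiplicity_function :: "(real ^ 'n) set \<Rightarrow> (real ^ 'n \<Rightarrow> real) \<Rightarrow> bool" where
  "multiplicity_function R k \<longleftrightarrow>
     (\<forall>\<alpha>\<in>R. 0 \<le> k \<alpha>) \<and> (\<forall>g\<in>reflection_group R. \<forall>\<alpha>\<in>R. k (g \<alpha>) = k \<alpha>)"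

section \<open>Dunkl operators and the weighted measure\<close>

definition partial :: "'n \<Rightarrow> (real ^ 'n \<Rightarrow> real) \<Rightarrow> real ^ 'n \<Rightarrow> real" where
  "partial i u x = deriv (\<lambda>t. u (x + t *\<^sub>R axis i 1)) 0"

text \<open>On the hyperplanes \<open>\<alpha> \<bullet> x = 0\<close> the difference quotient below is \<open>0\<close> by the convention for
  division by zero, rather than its continuous extension. This is a null set for the measure
  \<open>dunkl_measure\<close> defined below.\<close>

definition dunkl_op ::
  "(real ^ 'n) set \<Rightarrow> (real ^ 'n \<Rightarrow> real) \<Rightarrow> 'n \<Rightarrow> (real ^ 'n \<Rightarrow> real) \<Rightarrow> real ^ 'n \<Rightarrow> real" where
  "dunkl_op Rp k i u x = partial i u x +
     (\<Sum>\<alpha>\<in>Rp. k \<alpha> * (\<alpha> $ i) * ((u x - u (reflection \<alpha> x)) / (\<alpha> \<bullet> x)))"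

definition dunkl_grad ::
  "(real ^ 'n) set \<Rightarrow> (real ^ 'n \<Rightarrow> real) \<Rightarrow> (real ^ 'n \<Rightarrow> real) \<Rightarrow> real ^ 'n \<Rightarrow> real ^ 'n" where
  "dunkl_grad Rp k u x = (\<chi> i. dunkl_op Rp k i u x)"

definition dunkl_gamma :: "(real ^ 'n) set \<Rightarrow> (real ^ 'n \<Rightarrow> real) \<Rightarrow> real" where
  "dunkl_gamma Rp k = (\<Sum>\<alpha>\<in>Rp. k \<alpha>)"

text \<open>Since \<open>0 powr 0 = 0\<close>, a factor with \<open>k \<alpha> = 0\<close> vanishes on the hyperplane \<open>\<alpha> \<bullet> x = 0\<close>
  instead of being \<open>1\<close>; again this only concerns a null set.\<close>

definition dunkl_weight :: "(real ^ 'n) set \<Rightarrow> (real ^ 'n \<Rightarrow> real) \<Rightarrow> real ^ 'n \<Rightarrow> real" where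
  "dunkl_weight Rp k x = (\<Prod>\<alpha>\<in>Rp. \<bar>\<alpha> \<bullet> x\<bar> powr (2 * k \<alpha>))"

definition dunkl_measure :: "(real ^ 'n) set \<Rightarrow> (real ^ 'n \<Rightarrow> real) \<Rightarrow> (real ^ 'n) measure" where
  "dunkl_measure Rp k = density lborel (\<lambda>x. ennreal (dunkl_weight Rp k x))"

section \<open>Test functions\<close>

primrec times_cont_diff :: "nat \<Rightarrow> (real ^ 'n \<Rightarrow> real) \<Rightarrow> bool" where
  "times_cont_diff 0 u \<longleftrightarrow> continuous_on UNIV u"
| "times_cont_diff (Suc m) u \<longleftrightarrow>
     (\<forall>x. u differentiable (at x)) \<and> (\<forall>i. times_cont_diff m (partial i u))"

text \<open>Elements of \<open>C\<^sub>0\<^sup>\<infinity>(\<Omega>)\<close> are identified with their extensions by zero to the whole space.\<close>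

definition test_function_on :: "(real ^ 'n) set \<Rightarrow> (real ^ 'n \<Rightarrow> real) \<Rightarrow> bool" where
  "test_function_on \<Omega> u \<longleftrightarrow>
     (\<forall>m. times_cont_diff m u) \<and> compact (closure {x. u x \<noteq> 0}) \<and> closure {x. u x \<noteq> 0} \<subseteq> \<Omega>"

section \<open>The exterior domain\<close>

definition exterior_ball :: "real \<Rightarrow> (real ^ 'n) set" where
  "exterior_ball r = {x. norm x > r}"

definition boundary_dist :: "(real ^ 'n) set \<Rightarrow> real ^ 'n \<Rightarrow> real" where
  "boundary_dist \<Omega> x = infdist x (frontier \<Omega>)"

lemma boundary_dist_exterior_ball:
  fixes x :: "real ^ 'n"
  assumes "r > 0" "x \<in> exterior_ball r"
  shows "boundary_dist (exterior_ball r) x = norm x - r"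
proof -
  have "exterior_ball r = - (cball 0 r :: (real ^ 'n) set)"
    by (auto simp: exterior_ball_def)
  then have fr: "frontier (exterior_ball r :: (real ^ 'n) set) = sphere 0 r"
    using assms by simp
  have x: "norm x > r" using assms by (simp add: exterior_ball_def)
  then have nz: "x \<noteq> 0" using assms(1) by auto
  define y where "y = (r / norm x) *\<^sub>R x"
  have y: "y \<in> sphere 0 r" using nz assms by (simp add: y_def)
  have "x - y = (1 - r / norm x) *\<^sub>R x"
    by (simp add: y_def scaleR_diff_left)
  then have "dist x y = \<bar>1 - r / norm x\<bar> * norm x"
    by (simp add: dist_norm)
  also have "\<dots> = norm x - r"
  proof -
    have "r / norm x < 1" using x nz by simp
    then show ?thesis using nz by (simp add: abs_if left_diff_distrib)
  qed
  finally have "infdist x (sphere 0 r) \<le> norm x - r"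
    using infdist_le[OF y, of x] by simp
  moreover have "norm x - r \<le> infdist x (sphere 0 r)"
  proof -
    have ne: "sphere (0 :: real ^ 'n) r \<noteq> {}" using y by blast
    have "norm x - r \<le> dist x z" if "z \<in> sphere 0 r" for z
      using that norm_triangle_ineq2[of x z] by (simp add: dist_norm)
    then show ?thesis using ne by (auto simp: infdist_def intro!: cINF_greatest)
  qed
  ultimately show ?thesis by (simp add: boundary_dist_def fr)
qed

end

theory Submission
  imports Defs
begin

text \<open>
  Write \<open>\<delta> = |x| - r\<close>, \<open>d = N + 2\<gamma>\<close> and \<open>E u = x \<bullet> \<nabla>u\<close>. The reason for the inequality is that the
  radial part of the Dunkl gradient controls \<open>u\<close> at least as well as the ordinary radial
  derivative does. Since \<open>\<langle>\<alpha>,x\<rangle>\<close> cancels,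
  \<open>x \<bullet> \<nabla>\<^sub>k u = E u + \<Sum> k\<^sub>\<alpha> (u - u \<circ> \<sigma>\<^sub>\<alpha>)\<close> (\<open>inner_dunkl_grad\<close>). Test this against
  \<open>\<phi> |u|\<^sup>p\<^sup>-\<^sup>2 u\<close>, where \<open>\<phi> = \<delta>\<^sup>1\<^sup>-\<^sup>p / |x|\<close> is radial. The difference terms contribute a nonnegative
  amount: by Young's inequality \<open>|u|\<^sup>p\<^sup>-\<^sup>2 u (u \<circ> \<sigma>\<^sub>\<alpha>)\<close> is at most a convex combination of \<open>|u|\<^sup>p\<close> and
  \<open>|u \<circ> \<sigma>\<^sub>\<alpha>|\<^sup>p\<close>, and these have the same integral against \<open>\<phi> d\<mu>\<^sub>k\<close> because \<open>\<phi>\<close> and \<open>\<mu>\<^sub>k\<close> are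
  invariant under \<open>\<sigma>\<^sub>\<alpha>\<close> (\<open>integral_spow_difference_nonneg\<close>).

  For the term with \<open>E u\<close>, the measure \<open>\<mu>\<^sub>k\<close> is homogeneous of degree \<open>d\<close>, so differentiating
  \<open>\<integral> v(tx) d\<mu>\<^sub>k = t\<^sup>-\<^sup>d \<integral> v d\<mu>\<^sub>k\<close> at \<open>t = 1\<close> gives \<open>\<integral> E v d\<mu>\<^sub>k = -d \<integral> v d\<mu>\<^sub>k\<close>
  (\<open>integral_dilation_derivative\<close>). This replaces the divergence theorem and avoids derivatives of the
  weight, which need not be differentiable on the reflecting hyperplanes. With \<open>v = \<phi> |u|\<^sup>p\<close> it
  yields
  \<open>p \<integral> \<phi> |u|\<^sup>p\<^sup>-\<^sup>2 u E u d\<mu>\<^sub>k = \<integral> ((p - 1) \<delta>\<^sup>-\<^sup>p - (d - 1) \<phi>) |u|\<^sup>p d\<mu>\<^sub>k \<ge> (p - d) \<integral> |u|\<^sup>p \<delta>\<^sup>-\<^sup>p d\<mu>\<^sub>k\<close>,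
  because \<open>d \<ge> 1\<close> and \<open>\<phi> \<le> \<delta>\<^sup>-\<^sup>p\<close> (\<open>hardy_flux_inequality\<close>).

  Finally, with \<open>c = (p - d)/p\<close>, a pointwise Young inequality with the weight \<open>c\<close>
  (\<open>hardy_flux_Young\<close>) takes the place of Hoelder's inequality and produces the constant \<open>c\<^sup>p\<close>.
\<close>

section \<open>Orthogonal invariance of Lebesgue measure\<close>

lemma nn_integral_lborel_translate:
  fixes c :: "'a::euclidean_space"
  assumes [measurable]: "f \<in> borel_measurable borel"
  shows "(\<integral>\<^sup>+y. f (c + y) \<partial>lborel) = (\<integral>\<^sup>+y. f y \<partial>lborel)"
proof -
  have "(\<integral>\<^sup>+y. f y \<partial>lborel) = (\<integral>\<^sup>+y. f y \<partial>distr lborel borel ((+) c))"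
    by (simp add: lborel_distr_plus)
  also have "\<dots> = (\<integral>\<^sup>+y. f (c + y) \<partial>lborel)"
    by (rule nn_integral_distr) auto
  finally show ?thesis by simp
qed

text \<open>The argument is the one for uniqueness of Haar measure. For the unit ball \<open>B\<close>, the integral
  of \<open>1\<^sub>A(x) 1\<^sub>B(x - f y)\<close> over all \<open>x\<close> and \<open>y\<close> is evaluated in both orders. Translation invariance
  and \<open>|f y| = |y|\<close> give \<open>|A| |B|\<close> in one order and \<open>|f\<^sup>-\<^sup>1 A| |B|\<close> in the other, and
  \<open>0 < |B| < \<infinity>\<close>.\<close>

lemma orthogonal_image_lborel:
  fixes f :: "'a::euclidean_space \<Rightarrow> 'a"
  assumes f: "orthogonal_transformation f"
  shows "distr lborel borel f = lborel"
proof (rule measure_eqI)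
  show "sets (distr lborel borel f) = sets lborel" by simp
next
  fix A assume "A \<in> sets (distr lborel borel f)"
  then have A [measurable]: "A \<in> sets borel" by simp
  have lin: "linear f" by (rule orthogonal_transformation_linear[OF f])
  have [measurable]: "f \<in> borel_measurable borel"
    by (intro borel_measurable_continuous_onI linear_continuous_on linear_conv_bounded_linear[THEN iffD1] lin)
  define g where "g = inv_into UNIV f"
  have surj: "surj f" by (rule orthogonal_transformation_surj[OF f])
  have fg: "f (g x) = x" for x by (simp add: g_def surj_f_inv_f[OF surj])
  define B where "B = (ball 0 1 :: 'a set)"
  have [measurable]: "B \<in> sets borel" by (simp add: B_def)
  have nf: "norm (f y) = norm y" for y by (rule orthogonal_transformation_norm[OF f])
  have B_eq: "indicator B (x - f y) = (indicator B (- g x + y) :: ennreal)" for x y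
  proof -
    have "x - f y = f (g x - y)" by (simp add: linear_diff[OF lin] fg)
    then have "norm (x - f y) = norm (g x - y)" by (simp only: nf)
    also have "\<dots> = norm (- g x + y)"
      using norm_minus_commute[of "g x" y] by (simp add: add.commute)
    finally show ?thesis by (simp add: B_def indicator_def)
  qed
  have A_eq: "indicator A (f y + z) = (indicator A (f (g z + y)) :: ennreal)" for y z
    by (simp add: linear_add[OF lin] fg add.commute)
  have meas [measurable]: "(\<lambda>x. indicator A (f x) :: ennreal) \<in> borel_measurable borel"
    by measurable
  have "emeasure lborel A * emeasure lborel B
      = (\<integral>\<^sup>+x. indicator A x * emeasure lborel B \<partial>lborel)"
    by (simp add: nn_integral_multc)
  also have "\<dots> = (\<integral>\<^sup>+x. indicator A x * (\<integral>\<^sup>+y. indicator B (x - f y) \<partial>lborel) \<partial>lborel)"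
  proof -
    have "(\<integral>\<^sup>+y. indicator B (x - f y) \<partial>lborel) = emeasure lborel B" for x
    proof -
      have "(\<integral>\<^sup>+y. indicator B (- g x + y) \<partial>lborel) = (\<integral>\<^sup>+y. indicator B y \<partial>lborel)"
        by (rule nn_integral_lborel_translate) simp
      then show ?thesis by (simp only: B_eq) simp
    qed
    then show ?thesis by simp
  qed
  also have "\<dots> = (\<integral>\<^sup>+x. \<integral>\<^sup>+y. indicator A x * indicator B (x - f y) \<partial>lborel \<partial>lborel)"
    by (simp add: nn_integral_cmult)
  also have "\<dots> = (\<integral>\<^sup>+y. \<integral>\<^sup>+x. indicator A x * indicator B (x - f y) \<partial>lborel \<partial>lborel)"
    by (rule lborel_pair.Fubini'[symmetric]) measurable
  also have "\<dots> = (\<integral>\<^sup>+y. \<integral>\<^sup>+z. indicator A (f y + z) * indicator B z \<partial>lborel \<partial>lborel)"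
  proof (rule nn_integral_cong)
    fix y
    have "(\<integral>\<^sup>+z. indicator A (f y + z) * indicator B ((f y + z) - f y) \<partial>lborel)
        = (\<integral>\<^sup>+x. indicator A x * indicator B (x - f y) \<partial>lborel)"
      by (rule nn_integral_lborel_translate) measurable
    then show "(\<integral>\<^sup>+x. indicator A x * indicator B (x - f y) \<partial>lborel)
        = (\<integral>\<^sup>+z. indicator A (f y + z) * indicator B z \<partial>lborel)" by simp
  qed
  also have "\<dots> = (\<integral>\<^sup>+z. \<integral>\<^sup>+y. indicator A (f y + z) * indicator B z \<partial>lborel \<partial>lborel)"
    by (rule lborel_pair.Fubini') measurable
  \<comment> \<open>\<open>f y + z = f (y + f\<^sup>-\<^sup>1 z)\<close>, so the shift by \<open>z\<close> becomes a translation of \<open>y\<close>\<close>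
  also have "\<dots> = (\<integral>\<^sup>+z. (\<integral>\<^sup>+y. indicator A (f (g z + y)) \<partial>lborel) * indicator B z \<partial>lborel)"
    unfolding A_eq by (simp add: nn_integral_multc)
  also have "\<dots> = (\<integral>\<^sup>+z. (\<integral>\<^sup>+y. indicator A (f y) \<partial>lborel) * indicator B z \<partial>lborel)"
    using nn_integral_lborel_translate[OF meas] by simp
  also have "\<dots> = (\<integral>\<^sup>+y. indicator A (f y) \<partial>lborel) * emeasure lborel B"
    by (simp add: nn_integral_cmult)
  also have "(\<integral>\<^sup>+y. indicator A (f y) \<partial>lborel) = (\<integral>\<^sup>+x. indicator A x \<partial>distr lborel borel f)"
    by (rule nn_integral_distr[symmetric]) auto
  also have "\<dots> = emeasure (distr lborel borel f) A" by simp
  finally have eq: "emeasure lborel A * emeasure lborel B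
      = emeasure (distr lborel borel f) A * emeasure lborel B" .
  have "emeasure lborel B \<noteq> 0"
  proof
    assume "emeasure lborel B = 0"
    then have "negligible B"
      by (simp add: negligible_iff_null_sets null_setsI null_sets_completionI B_def)
    then show False using open_not_negligible[of B] by (simp add: B_def)
  qed
  moreover have "emeasure lborel B \<noteq> \<infinity>"
    using emeasure_bounded_finite[of B] by (auto simp: B_def)
  ultimately show "emeasure (distr lborel borel f) A = emeasure lborel A"
    using eq by (metis ennreal_mult_divide_eq infinity_ennreal_def)
qed

section \<open>Integration by parts along dilations\<close>

lemma vanishing_off_compact_bounded_measurable:
  fixes f :: "'a::euclidean_space \<Rightarrow> real"
  assumes K: "compact K" and f: "continuous_on K f" and off: "\<And>x. x \<notin> K \<Longrightarrow> f x = 0"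
  shows "f \<in> borel_measurable borel" "\<exists>C. \<forall>x. \<bar>f x\<bar> \<le> C"
proof -
  have "(\<lambda>x. indicator K x *\<^sub>R f x) \<in> borel_measurable borel"
    by (intro borel_measurable_continuous_on_indicator f borel_compact K)
  also have "(\<lambda>x. indicator K x *\<^sub>R f x) = f"
    using off by (auto simp: indicator_def fun_eq_iff)
  finally show "f \<in> borel_measurable borel" .
  obtain C where C: "\<And>x. x \<in> K \<Longrightarrow> norm (f x) \<le> C"
    using compact_imp_bounded[OF compact_continuous_image[OF f K]] by (auto simp: bounded_iff)
  have "\<bar>f x\<bar> \<le> max C 0" for x using C[of x] off[of x] by (cases "x \<in> K") auto
  then show "\<exists>C. \<forall>x. \<bar>f x\<bar> \<le> C" by blast
qed

lemma integrable_vanishing_off_compact: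
  fixes f :: "'a::euclidean_space \<Rightarrow> real"
  assumes "sets M = sets borel" "\<And>K. compact K \<Longrightarrow> emeasure M K < \<infinity>"
    and K: "compact K" and f: "continuous_on K f" and off: "\<And>x. x \<notin> K \<Longrightarrow> f x = 0"
  shows "integrable M f"
proof -
  obtain C where "\<And>x. \<bar>f x\<bar> \<le> C"
    using vanishing_off_compact_bounded_measurable(2)[OF K f off] by blast
  then show ?thesis
    using vanishing_off_compact_bounded_measurable(1)[OF K f off] off assms(2)[OF K] K
    by (intro integrableI_bounded_set[where A = K and B = C])
       (auto simp: assms(1) measurable_cong_sets[OF assms(1) refl] borel_compact)
qed

text \<open>Integration by parts for the Euler field \<open>x \<bullet> \<nabla>\<close> (\<open>w\<close> is \<open>x \<bullet> \<nabla>v\<close>) with respect to a measure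
  that is homogeneous of degree \<open>d\<close>: both sides are the derivative of \<open>t \<mapsto> \<integral> v(tx) dM\<close> at
  \<open>t = 1\<close>. By the mean value theorem the difference quotients with \<open>t > 1\<close> are bounded by \<open>sup |w|\<close>,
  and they vanish outside a fixed ball, so dominated convergence applies.\<close>

lemma integral_dilation_derivative:
  fixes v w :: "'a::euclidean_space \<Rightarrow> real"
  assumes sets: "sets M = sets borel" and fin: "\<And>K. compact K \<Longrightarrow> emeasure M K < \<infinity>"
    and hom: "\<And>t (f :: 'a \<Rightarrow> real). 0 < t \<Longrightarrow> f \<in> borel_measurable borel \<Longrightarrow>
       (\<integral>x. f (t *\<^sub>R x) \<partial>M) = t powr (- d) * (\<integral>x. f x \<partial>M)"
    and K: "compact K"
    and v: "continuous_on K v" "\<And>x. x \<notin> K \<Longrightarrow> v x = 0"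
    and w: "continuous_on K w" "\<And>x. x \<notin> K \<Longrightarrow> w x = 0"
    and deriv: "\<And>x. ((\<lambda>t. v (t *\<^sub>R x)) has_real_derivative w x) (at 1)"
  shows "(\<integral>x. w x \<partial>M) = - d * (\<integral>x. v x \<partial>M)"
proof -
  note [measurable_cong] = sets
  have [measurable]: "v \<in> borel_measurable borel" "w \<in> borel_measurable borel"
    using vanishing_off_compact_bounded_measurable[OF K] v w by auto
  obtain C where C: "\<And>x. \<bar>w x\<bar> \<le> C"
    using vanishing_off_compact_bounded_measurable(2)[OF K w] by blast
  obtain D where D: "\<And>x. \<bar>v x\<bar> \<le> D"
    using vanishing_off_compact_bounded_measurable(2)[OF K v] by blast
  obtain b where b: "b > 0" "\<And>x. x \<in> K \<Longrightarrow> norm x \<le> b"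
    using compact_imp_bounded[OF K] unfolding bounded_pos by blast
  have deriv_at: "((\<lambda>t. v (t *\<^sub>R x)) has_real_derivative w (s *\<^sub>R x) / s) (at s)" if "s > 0" for s x
  proof -
    have "((\<lambda>t. v (t *\<^sub>R (s *\<^sub>R x))) has_real_derivative w (s *\<^sub>R x)) (at (s / s))"
      using deriv[of "s *\<^sub>R x"] that by simp
    then have "((\<lambda>t. v ((t / s) *\<^sub>R (s *\<^sub>R x))) has_real_derivative w (s *\<^sub>R x) * (1 / s)) (at s)"
      by (rule DERIV_chain2) (rule DERIV_cdivide, rule DERIV_ident)
    then show ?thesis using that by simp
  qed
  \<comment> \<open>Step sizes: the dilations used are those by \<open>1 + h n > 1\<close>, which keep points with
    \<open>norm x > b\<close> outside \<open>K\<close>.\<close>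
  define h where "h n = inverse (real (Suc n))" for n
  have h: "0 < h n" for n by (simp add: h_def)
  have h0: "h \<longlonglongrightarrow> 0" unfolding h_def by (rule LIMSEQ_inverse_real_of_nat)
  have h_at: "filterlim h (at 0) sequentially"
  proof -
    have "h n \<noteq> 0" for n using h[of n] by simp
    then show ?thesis using h0 by (simp add: filterlim_at)
  qed
  define s where "s n x = (v ((1 + h n) *\<^sub>R x) - v x) / h n" for n x
  have v_far: "v ((1 + h n) *\<^sub>R x) = 0" if "norm x > b" for n x
  proof -
    have "norm x * 1 \<le> norm x * (1 + h n)" using h[of n] by (intro mult_left_mono) auto
    then have "norm ((1 + h n) *\<^sub>R x) > b" using that h[of n] by (simp add: mult.commute)
    then show ?thesis using b v(2) by fastforce
  qed
  have v_far0: "v x = 0" if "norm x > b" for x using b(2)[of x] v(2)[of x] that by force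
  have s_bound: "norm (s n x) \<le> indicator (cball 0 b) x * C" for n x
  proof (cases "norm x > b")
    case True
    then show ?thesis by (simp add: s_def v_far v_far0)
  next
    case False
    have "\<exists>z>1. z < 1 + h n \<and>
        v ((1 + h n) *\<^sub>R x) - v (1 *\<^sub>R x) = (1 + h n - 1) * (w (z *\<^sub>R x) / z)"
      by (rule MVT2) (use h[of n] in \<open>auto intro!: deriv_at\<close>)
    then obtain z where z: "1 < z" "z < 1 + h n"
      "v ((1 + h n) *\<^sub>R x) - v (1 *\<^sub>R x) = (1 + h n - 1) * (w (z *\<^sub>R x) / z)" by blast
    then have "norm (s n x) = \<bar>w (z *\<^sub>R x)\<bar> / z" using h[of n] by (simp add: s_def abs_mult)
    also have "\<dots> \<le> \<bar>w (z *\<^sub>R x)\<bar> / 1" by (rule divide_left_mono) (use z in auto)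
    also have "\<dots> \<le> C" using C by simp
    finally show ?thesis using False by simp
  qed
  have int_b: "integrable M (f :: 'a \<Rightarrow> real)"
    if "f \<in> borel_measurable borel" "\<And>x. norm x > b \<Longrightarrow> f x = 0" "\<And>x. \<bar>f x\<bar> \<le> c" for f c
    using that fin[of "cball 0 b"]
    by (intro integrableI_bounded_set[where A = "cball 0 b" and B = c]) (auto simp: not_le)
  have "(\<lambda>n. \<integral>x. s n x \<partial>M) \<longlonglongrightarrow> (\<integral>x. w x \<partial>M)"
  proof (rule integral_dominated_convergence)
    show "integrable M (\<lambda>x. indicator (cball 0 b) x * C)"
      by (rule int_b[where c = "\<bar>C\<bar>"]) (auto simp: indicator_def)
    show "AE x in M. (\<lambda>n. s n x) \<longlonglongrightarrow> w x"
    proof (rule AE_I2)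
      fix x
      have "((\<lambda>h. (v ((1 + h) *\<^sub>R x) - v (1 *\<^sub>R x)) / h) \<longlongrightarrow> w x) (at 0)"
        using deriv[of x] unfolding DERIV_def .
      then show "(\<lambda>n. s n x) \<longlonglongrightarrow> w x"
        unfolding s_def using filterlim_compose[OF _ h_at] by force
    qed
    show "AE x in M. norm (s n x) \<le> indicator (cball 0 b) x * C" for n using s_bound by simp
  qed (auto simp: s_def)
  moreover have "(\<integral>x. s n x \<partial>M) = ((1 + h n) powr (- d) - 1 powr (- d)) / h n * (\<integral>x. v x \<partial>M)" for n
  proof -
    have "integrable M v" using D v_far0 by (intro int_b) auto
    moreover have "integrable M (\<lambda>x. v ((1 + h n) *\<^sub>R x))" using D v_far by (intro int_b) auto
    ultimately show ?thesis
      using hom[of "1 + h n" v] h[of n] by (simp add: s_def field_simps)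
  qed
  moreover have "(\<lambda>n. ((1 + h n) powr (- d) - 1 powr (- d)) / h n * (\<integral>x. v x \<partial>M))
      \<longlonglongrightarrow> - d * (\<integral>x. v x \<partial>M)"
  proof (rule tendsto_mult_right)
    have "((\<lambda>t. t powr (- d)) has_real_derivative - d) (at 1)"
      by (auto intro!: derivative_eq_intros)
    then have "((\<lambda>h. ((1 + h) powr (- d) - 1 powr (- d)) / h) \<longlongrightarrow> - d) (at 0)"
      unfolding DERIV_def .
    then show "(\<lambda>n. ((1 + h n) powr (- d) - 1 powr (- d)) / h n) \<longlonglongrightarrow> - d"
      using filterlim_compose[OF _ h_at] by force
  qed
  ultimately show ?thesis using LIMSEQ_unique by auto
qed

section \<open>Symmetries of the Dunkl measure\<close>

lemma orthogonal_transformation_reflection: "orthogonal_transformation (reflection \<alpha>)"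
proof -
  have "linear (reflection \<alpha>)"
    by (rule linearI) (simp_all add: reflection_def inner_add_right algebra_simps add_divide_distrib)
  moreover have "reflection \<alpha> x \<bullet> reflection \<alpha> y = x \<bullet> y" for x y
    by (cases "\<alpha> = 0")
       (simp_all add: reflection_def inner_diff_left inner_diff_right inner_commute field_simps)
  ultimately show ?thesis by (simp add: orthogonal_transformation_def)
qed

lemma inner_reflection_left: "reflection \<alpha> x \<bullet> y = x \<bullet> reflection \<alpha> y"
  by (simp add: reflection_def inner_diff_left inner_diff_right inner_commute)

lemma reflection_self: "\<alpha> \<noteq> 0 \<Longrightarrow> reflection \<alpha> \<alpha> = - \<alpha>"
  by (simp add: reflection_def scaleR_2)

lemma borel_measurable_reflection [measurable]: "reflection \<alpha> \<in> borel_measurable borel"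
  using orthogonal_transformation_linear[OF orthogonal_transformation_reflection]
  by (intro borel_measurable_continuous_onI linear_continuous_on) (simp add: linear_conv_bounded_linear)

lemma norm_reflection: "norm (reflection \<alpha> x) = norm x"
  by (rule orthogonal_transformation_norm[OF orthogonal_transformation_reflection])

lemma multiplicity_function_reflection:
  assumes "multiplicity_function R k" "\<alpha> \<in> R" "\<beta> \<in> R"
  shows "k (reflection \<alpha> \<beta>) = k \<beta>"
  using assms unfolding multiplicity_function_def reflection_group_def
  by (blast intro: generate.incl)

lemma positive_subsystem_finite: "root_system R \<Longrightarrow> positive_subsystem R Rp \<Longrightarrow> finite Rp"
  by (auto simp: root_system_def positive_subsystem_def)

text \<open>Since \<open>k\<^sub>\<alpha> = k\<^sub>-\<^sub>\<alpha>\<close>, the square in each factor of the weight can be distributed over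
  \<open>\<alpha>\<close> and \<open>- \<alpha>\<close>. A product over the whole of \<open>R\<close> is visibly invariant, because reflections permute
  \<open>R\<close> although they need not preserve \<open>Rp\<close>.\<close>

lemma dunkl_weight_eq_prod_roots:
  assumes R: "root_system R" and Rp: "positive_subsystem R Rp" and k: "multiplicity_function R k"
  shows "dunkl_weight Rp k x = (\<Prod>\<alpha>\<in>R. \<bar>\<alpha> \<bullet> x\<bar> powr k \<alpha>)"
proof -
  have fin: "finite Rp" by (rule positive_subsystem_finite[OF R Rp])
  have k_minus: "k (- \<alpha>) = k \<alpha>" if "\<alpha> \<in> Rp" for \<alpha>
  proof -
    have "\<alpha> \<in> R" "\<alpha> \<noteq> 0" using that R Rp by (auto simp: positive_subsystem_def root_system_def)
    then show ?thesis
      using multiplicity_function_reflection[OF k, of \<alpha> \<alpha>] by (simp add: reflection_self)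
  qed
  have "(\<Prod>\<alpha>\<in>R. \<bar>\<alpha> \<bullet> x\<bar> powr k \<alpha>)
      = (\<Prod>\<alpha>\<in>Rp. \<bar>\<alpha> \<bullet> x\<bar> powr k \<alpha>) * (\<Prod>\<alpha>\<in>uminus ` Rp. \<bar>\<alpha> \<bullet> x\<bar> powr k \<alpha>)"
    using prod.union_disjoint[of Rp "uminus ` Rp" "\<lambda>\<alpha>. \<bar>\<alpha> \<bullet> x\<bar> powr k \<alpha>"] Rp fin
    by (simp add: positive_subsystem_def)
  also have "(\<Prod>\<alpha>\<in>uminus ` Rp. \<bar>\<alpha> \<bullet> x\<bar> powr k \<alpha>) = (\<Prod>\<alpha>\<in>Rp. \<bar>\<alpha> \<bullet> x\<bar> powr k \<alpha>)"
    by (subst prod.reindex) (auto simp: k_minus intro!: prod.cong)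
  also have "(\<Prod>\<alpha>\<in>Rp. \<bar>\<alpha> \<bullet> x\<bar> powr k \<alpha>) * (\<Prod>\<alpha>\<in>Rp. \<bar>\<alpha> \<bullet> x\<bar> powr k \<alpha>) = dunkl_weight Rp k x"
    unfolding dunkl_weight_def by (simp add: prod.distrib[symmetric] powr_add[symmetric])
  finally show ?thesis by simp
qed

lemma dunkl_weight_reflection:
  assumes R: "root_system R" and Rp: "positive_subsystem R Rp" and k: "multiplicity_function R k"
    and \<alpha>: "\<alpha> \<in> R"
  shows "dunkl_weight Rp k (reflection \<alpha> x) = dunkl_weight Rp k x"
proof -
  have bij: "bij_betw (reflection \<alpha>) R R"
    unfolding bij_betw_def
  proof
    show "inj_on (reflection \<alpha>) R" by (rule inj_on_inverseI) (rule reflection_reflection)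
    show "reflection \<alpha> ` R = R" using R \<alpha> by (simp add: root_system_def)
  qed
  have "(\<Prod>\<beta>\<in>R. \<bar>\<beta> \<bullet> x\<bar> powr k \<beta>)
      = (\<Prod>\<beta>\<in>R. \<bar>reflection \<alpha> \<beta> \<bullet> x\<bar> powr k (reflection \<alpha> \<beta>))"
    by (rule prod.reindex_bij_betw[OF bij, symmetric])
  also have "\<dots> = (\<Prod>\<beta>\<in>R. \<bar>\<beta> \<bullet> reflection \<alpha> x\<bar> powr k \<beta>)"
    by (intro prod.cong) (simp_all add: inner_reflection_left multiplicity_function_reflection[OF k \<alpha>])
  finally show ?thesis by (simp add: dunkl_weight_eq_prod_roots[OF R Rp k])
qed

lemma borel_measurable_dunkl_weight [measurable]: "dunkl_weight Rp k \<in> borel_measurable borel"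
  unfolding dunkl_weight_def by measurable

lemma dunkl_weight_nonneg: "0 \<le> dunkl_weight Rp k x"
  unfolding dunkl_weight_def by (simp add: prod_nonneg)

lemma sets_dunkl_measure [measurable_cong]: "sets (dunkl_measure Rp k) = sets borel"
  by (simp add: dunkl_measure_def)

lemma distr_dunkl_measure_reflection:
  assumes "root_system R" "positive_subsystem R Rp" "multiplicity_function R k" "\<alpha> \<in> R"
  shows "distr (dunkl_measure Rp k) borel (reflection \<alpha>) = dunkl_measure Rp k"
proof -
  have "density (distr lborel borel (reflection \<alpha>)) (\<lambda>x. ennreal (dunkl_weight Rp k x))
      = distr (density lborel (\<lambda>x. ennreal (dunkl_weight Rp k (reflection \<alpha> x)))) borel (reflection \<alpha>)"
    by (rule density_distr) auto
  then show ?thesis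
    by (simp add: orthogonal_image_lborel[OF orthogonal_transformation_reflection]
        dunkl_weight_reflection[OF assms] dunkl_measure_def)
qed

lemma dunkl_weight_scaleR:
  assumes "0 < t"
  shows "dunkl_weight Rp k (t *\<^sub>R x) = t powr (2 * dunkl_gamma Rp k) * dunkl_weight Rp k x"
proof -
  have "dunkl_weight Rp k (t *\<^sub>R x) = (\<Prod>\<alpha>\<in>Rp. t powr (2 * k \<alpha>) * \<bar>\<alpha> \<bullet> x\<bar> powr (2 * k \<alpha>))"
    unfolding dunkl_weight_def using assms by (simp add: abs_mult powr_mult)
  also have "\<dots> = t powr (2 * dunkl_gamma Rp k) * dunkl_weight Rp k x"
    unfolding prod.distrib dunkl_weight_def
    using powr_sum[of t "\<lambda>\<alpha>. 2 * k \<alpha>" Rp] assms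
    by (cases "finite Rp") (simp_all add: dunkl_gamma_def sum_distrib_left)
  finally show ?thesis .
qed

text \<open>Lebesgue measure contributes the degree \<open>N\<close> and the weight the degree \<open>2\<gamma>\<close>.\<close>

lemma integral_dunkl_measure_dilation:
  fixes f :: "real ^ 'n \<Rightarrow> real"
  assumes t: "0 < t" and [measurable]: "f \<in> borel_measurable borel"
  shows "(\<integral>x. f (t *\<^sub>R x) \<partial>dunkl_measure Rp k)
    = t powr (- (real CARD('n) + 2 * dunkl_gamma Rp k)) * (\<integral>x. f x \<partial>dunkl_measure Rp k)"
proof -
  let ?w = "dunkl_weight Rp k" and ?g = "2 * dunkl_gamma Rp k"
  have "(\<integral>x. f x \<partial>dunkl_measure Rp k) = (\<integral>x. ?w x * f x \<partial>lborel)"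
    unfolding dunkl_measure_def by (simp add: integral_density dunkl_weight_nonneg)
  also have "\<dots> = (\<integral>x. ?w x * f x \<partial>density (distr lborel borel (\<lambda>x. 0 + t *\<^sub>R x)) (\<lambda>_. \<bar>t\<bar> ^ DIM(real ^ 'n)))"
    using lborel_affine[of t "0 :: real ^ 'n"] t by simp
  also have "\<dots> = t ^ CARD('n) * (\<integral>x. ?w (t *\<^sub>R x) * f (t *\<^sub>R x) \<partial>lborel)"
    using t by (simp add: integral_density integral_distr)
  also have "\<dots> = t ^ CARD('n) * t powr ?g * (\<integral>x. ?w x * f (t *\<^sub>R x) \<partial>lborel)"
    using t by (simp add: dunkl_weight_scaleR mult.assoc)
  also have "t ^ CARD('n) * t powr ?g = t powr (real CARD('n) + ?g)"
    using t by (simp add: powr_add powr_realpow)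
  also have "(\<integral>x. ?w x * f (t *\<^sub>R x) \<partial>lborel) = (\<integral>x. f (t *\<^sub>R x) \<partial>dunkl_measure Rp k)"
    unfolding dunkl_measure_def by (simp add: integral_density dunkl_weight_nonneg)
  finally show ?thesis using t by (simp add: mult.assoc[symmetric] powr_add[symmetric])
qed

lemma dunkl_measure_compact_finite:
  fixes Rp :: "(real ^ 'n) set"
  assumes k: "\<And>\<alpha>. \<alpha> \<in> Rp \<Longrightarrow> 0 \<le> k \<alpha>" and K: "compact K"
  shows "emeasure (dunkl_measure Rp k) K < \<infinity>"
proof -
  obtain b where b: "\<And>x. x \<in> K \<Longrightarrow> norm x \<le> b"
    using compact_imp_bounded[OF K] unfolding bounded_iff by blast
  define C where "C = (\<Prod>\<alpha>\<in>Rp. (norm \<alpha> * b) powr (2 * k \<alpha>))"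
  have w: "dunkl_weight Rp k x \<le> C" if "x \<in> K" for x
    unfolding dunkl_weight_def C_def
  proof (rule prod_mono, safe)
    fix \<alpha> assume "\<alpha> \<in> Rp"
    have "\<bar>\<alpha> \<bullet> x\<bar> \<le> norm \<alpha> * norm x" by (rule Cauchy_Schwarz_ineq2)
    also have "\<dots> \<le> norm \<alpha> * b" using b[OF that] by (intro mult_left_mono) auto
    finally show "\<bar>\<alpha> \<bullet> x\<bar> powr (2 * k \<alpha>) \<le> (norm \<alpha> * b) powr (2 * k \<alpha>)"
      using k[OF \<open>\<alpha> \<in> Rp\<close>] by (intro powr_mono2) auto
  qed simp
  have KB: "K \<in> sets borel" by (rule borel_compact[OF K])
  have "emeasure (dunkl_measure Rp k) K = (\<integral>\<^sup>+x. ennreal (dunkl_weight Rp k x) * indicator K x \<partial>lborel)"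
    unfolding dunkl_measure_def using KB by (subst emeasure_density) auto
  also have "\<dots> \<le> (\<integral>\<^sup>+x. ennreal C * indicator K x \<partial>lborel)"
    using w by (intro nn_integral_mono) (auto simp: indicator_def intro!: ennreal_leI)
  also have "\<dots> = ennreal C * emeasure lborel K"
    using KB by (simp add: nn_integral_cmult)
  also have "\<dots> < \<infinity>"
    using emeasure_bounded_finite[OF compact_imp_bounded[OF K]] by (simp add: ennreal_mult_less_top)
  finally show ?thesis .
qed

section \<open>Young's inequality and derivatives of powers\<close>

lemma Young_powr:
  fixes a b p :: real
  assumes p: "1 < p" and "0 \<le> a" "0 \<le> b"
  shows "p * (a powr (p - 1) * b) \<le> (p - 1) * a powr p + b powr p"
proof -
  define q where "q = p / (p - 1)"
  have q: "1 < q" "1 / q + 1 / p = 1" "(p - 1) * q = p" "1 / q = (p - 1) / p"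
    using p by (auto simp: q_def field_simps)
  have "a powr (p - 1) * b \<le> (a powr (p - 1)) powr q / q + b powr p / p"
    by (rule Youngs_inequality) (use q p assms in auto)
  also have "(a powr (p - 1)) powr q = a powr p" by (simp add: powr_powr q)
  also have "a powr p / q = (p - 1) / p * a powr p"
    using q(4) by (metis mult.commute mult.right_neutral times_divide_eq_right)
  finally have "p * (a powr (p - 1) * b) \<le> p * ((p - 1) / p * a powr p + b powr p / p)"
    using p by (intro mult_left_mono) auto
  also have "\<dots> = (p - 1) * a powr p + b powr p" using p by (simp add: field_simps)
  finally show ?thesis .
qed

text \<open>The odd power \<open>|s|\<^sup>a\<^sup>-\<^sup>1 s\<close>, for \<open>a > 0\<close> the derivative of \<open>|s|\<^sup>a\<^sup>+\<^sup>1 / (a + 1)\<close>.\<close>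

definition spow :: "real \<Rightarrow> real \<Rightarrow> real" where
  "spow s a = sgn s * \<bar>s\<bar> powr a"

lemma abs_spow: "\<bar>spow s a\<bar> = \<bar>s\<bar> powr a"
  by (cases "s = 0") (simp_all add: spow_def abs_mult abs_sgn_eq)

lemma spow_0 [simp]: "spow 0 a = 0"
  by (simp add: spow_def)

lemma spow_mult_self: "spow s (p - 1) * s = \<bar>s\<bar> powr p"
proof (cases "s = 0")
  case False
  have "spow s (p - 1) * s = \<bar>s\<bar> powr (p - 1) * \<bar>s\<bar>"
    by (simp add: spow_def abs_sgn mult_ac)
  also have "\<dots> = \<bar>s\<bar> powr (p - 1) * \<bar>s\<bar> powr 1" using False by simp
  also have "\<dots> = \<bar>s\<bar> powr p" by (simp only: powr_add[symmetric]) simp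
  finally show ?thesis .
qed simp

lemma continuous_on_spow [continuous_intros]:
  assumes "continuous_on A f" "0 < a"
  shows "continuous_on A (\<lambda>x. spow (f x) a)"
proof -
  have "continuous_on A (\<lambda>x. max (f x) 0 powr a - max (- f x) 0 powr a)"
    using assms by (intro continuous_intros continuous_on_powr') auto
  also have "(\<lambda>x. max (f x) 0 powr a - max (- f x) 0 powr a) = (\<lambda>x. spow (f x) a)"
    by (auto simp: spow_def fun_eq_iff max_def sgn_if)
  finally show ?thesis .
qed

lemma borel_measurable_spow [measurable]:
  assumes [measurable]: "f \<in> borel_measurable M"
  shows "(\<lambda>x. spow (f x) a) \<in> borel_measurable M"
proof -
  have "(\<lambda>x. sgn (f x) * \<bar>f x\<bar> powr a) \<in> borel_measurable M" by measurable
  then show ?thesis by (simp add: spow_def)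
qed

lemma DERIV_abs_powr:
  fixes p :: real
  assumes p: "1 < p"
  shows "((\<lambda>s. \<bar>s\<bar> powr p) has_real_derivative p * spow s (p - 1)) (at s)"
proof -
  consider "s > 0" | "s < 0" | "s = 0" by linarith
  then show ?thesis
  proof cases
    case 1
    have "((\<lambda>s. s powr p) has_real_derivative p * spow s (p - 1)) (at s)"
      using 1 by (auto intro!: derivative_eq_intros simp: spow_def)
    then show ?thesis
      by (rule has_field_derivative_transform_within_open[where S = "{0<..}"]) (use 1 in auto)
  next
    case 2
    have "((\<lambda>s. (- s) powr p) has_real_derivative p * spow s (p - 1)) (at s)"
      using 2 by (auto intro!: derivative_eq_intros simp: spow_def)
    then show ?thesis
      by (rule has_field_derivative_transform_within_open[where S = "{..<0}"]) (use 2 in auto)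
  next
    case 3
    have "continuous_on UNIV (\<lambda>h. spow h (p - 1))"
      using p by (intro continuous_intros) auto
    then have "isCont (\<lambda>h. spow h (p - 1)) 0"
      by (simp add: continuous_on_eq_continuous_at)
    then have "((\<lambda>h. spow h (p - 1)) \<longlongrightarrow> 0) (at 0)"
      by (simp add: isCont_def)
    then have "((\<lambda>h. (\<bar>0 + h\<bar> powr p - \<bar>0\<bar> powr p) / h) \<longlongrightarrow> 0) (at 0)"
      by (rule Lim_transform_eventually)
         (auto simp: eventually_at_filter spow_mult_self[symmetric] intro!: always_eventually)
    then show ?thesis using 3 by (simp add: DERIV_def)
  qed
qed

section \<open>Symmetrized difference terms\<close>

text \<open>The cross term \<open>|u|\<^sup>p\<^sup>-\<^sup>2 u (u \<circ> \<sigma>)\<close> is dominated, by Young's inequality, by a convex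
  combination of \<open>|u|\<^sup>p\<close> and \<open>|u \<circ> \<sigma>|\<^sup>p\<close>. Both have the same integral against the \<open>\<sigma>\<close>-invariant
  measure \<open>\<phi> dM\<close>, so the cross term integrates to at most \<open>\<integral> \<phi> |u|\<^sup>p dM\<close>.\<close>

lemma integral_spow_difference_nonneg:
  fixes u \<phi> :: "'a::topological_space \<Rightarrow> real"
  assumes p: "1 < p"
    and sets: "sets M = sets borel"
    and \<sigma>: "\<sigma> \<in> borel_measurable borel" "distr M borel \<sigma> = M"
    and \<phi>: "\<phi> \<in> borel_measurable borel" "\<And>x. 0 \<le> \<phi> x" "\<And>x. \<phi> (\<sigma> x) = \<phi> x"
    and u: "u \<in> borel_measurable borel"
    and int: "integrable M (\<lambda>x. \<phi> x * \<bar>u x\<bar> powr p)"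
  shows "integrable M (\<lambda>x. \<phi> x * (spow (u x) (p - 1) * (u x - u (\<sigma> x))))"
    and "0 \<le> (\<integral>x. \<phi> x * (spow (u x) (p - 1) * (u x - u (\<sigma> x))) \<partial>M)"
proof -
  note [measurable_cong] = sets
  note [measurable] = \<sigma>(1) \<phi>(1) u
  have \<sigma>M [measurable]: "\<sigma> \<in> measurable M borel" using \<sigma>(1) by simp
  define F where "F x = \<phi> x * \<bar>u x\<bar> powr p" for x
  have F_meas [measurable]: "F \<in> borel_measurable borel" unfolding F_def by measurable
  have F: "integrable M F" using int by (simp add: F_def[abs_def])
  have F\<sigma>: "integrable M (\<lambda>x. F (\<sigma> x))"
    using integrable_distr_eq[OF \<sigma>M F_meas] F \<sigma>(2) by simp
  have eq\<sigma>: "(\<integral>x. F (\<sigma> x) \<partial>M) = (\<integral>x. F x \<partial>M)"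
    using integral_distr[OF \<sigma>M F_meas] \<sigma>(2) by simp
  define G where "G x = \<phi> x * (spow (u x) (p - 1) * u (\<sigma> x))" for x
  have G_abs: "\<bar>G x\<bar> \<le> ((p - 1) * F x + F (\<sigma> x)) / p" for x
  proof -
    have "p * (\<bar>u x\<bar> powr (p - 1) * \<bar>u (\<sigma> x)\<bar>) \<le> (p - 1) * \<bar>u x\<bar> powr p + \<bar>u (\<sigma> x)\<bar> powr p"
      by (rule Young_powr[OF p]) auto
    then have "\<phi> x * (p * (\<bar>u x\<bar> powr (p - 1) * \<bar>u (\<sigma> x)\<bar>))
        \<le> \<phi> x * ((p - 1) * \<bar>u x\<bar> powr p + \<bar>u (\<sigma> x)\<bar> powr p)"
      by (rule mult_left_mono) (rule \<phi>(2))
    then have "p * \<bar>G x\<bar> \<le> (p - 1) * F x + F (\<sigma> x)"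
      using \<phi>(2) by (simp add: G_def F_def abs_mult abs_spow \<phi>(3) algebra_simps)
    then show ?thesis using p by (simp add: field_simps)
  qed
  have bound_int: "integrable M (\<lambda>x. ((p - 1) * F x + F (\<sigma> x)) / p)"
    using F F\<sigma> by simp
  have G: "integrable M G"
  proof (rule Bochner_Integration.integrable_bound[OF bound_int])
    show "G \<in> borel_measurable M" unfolding G_def by measurable
    show "AE x in M. norm (G x) \<le> norm (((p - 1) * F x + F (\<sigma> x)) / p)"
    proof (rule AE_I2)
      show "norm (G x) \<le> norm (((p - 1) * F x + F (\<sigma> x)) / p)" for x
        using G_abs[of x] unfolding real_norm_def by linarith
    qed
  qed
  have split: "(\<lambda>x. \<phi> x * (spow (u x) (p - 1) * (u x - u (\<sigma> x)))) = (\<lambda>x. F x - G x)"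
    by (simp add: fun_eq_iff F_def G_def spow_mult_self[symmetric] algebra_simps)
  show "integrable M (\<lambda>x. \<phi> x * (spow (u x) (p - 1) * (u x - u (\<sigma> x))))"
    unfolding split using F G by simp
  have "(\<integral>x. G x \<partial>M) \<le> (\<integral>x. ((p - 1) * F x + F (\<sigma> x)) / p \<partial>M)"
    using G bound_int abs_le_D1[OF G_abs] by (intro integral_mono) auto
  also have "\<dots> = (\<integral>x. F x \<partial>M)"
    using F F\<sigma> eq\<sigma> p by (simp add: field_simps)
  finally show "0 \<le> (\<integral>x. \<phi> x * (spow (u x) (p - 1) * (u x - u (\<sigma> x))) \<partial>M)"
    unfolding split using F G by simp
qed

section \<open>The radial component of the Dunkl gradient\<close>

definition euler_op :: "(real ^ 'n \<Rightarrow> real) \<Rightarrow> real ^ 'n \<Rightarrow> real" where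
  "euler_op u x = (\<Sum>i\<in>UNIV. x $ i * partial i u x)"

lemma DERIV_dilation:
  assumes "u differentiable (at x)"
  shows "((\<lambda>t. u (t *\<^sub>R x)) has_real_derivative euler_op u x) (at 1)"
proof -
  obtain f' where f': "(u has_derivative f') (at x)"
    using assms by (auto simp: differentiable_def)
  have lin: "linear f'" using f' by (simp add: has_derivative_linear)
  have partial: "partial i u x = f' (axis i 1)" for i
  proof -
    have "((\<lambda>t. u (x + t *\<^sub>R axis i 1)) has_derivative (\<lambda>t. f' (t *\<^sub>R axis i 1))) (at 0)"
      by (rule has_derivative_compose[where g = u])
         (use f' in \<open>auto intro!: derivative_eq_intros\<close>)
    then have "((\<lambda>t. u (x + t *\<^sub>R axis i 1)) has_real_derivative f' (axis i 1)) (at 0)"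
      by (rule has_derivative_imp_has_field_derivative) (simp add: linear_cmul[OF lin])
    then show ?thesis unfolding partial_def by (rule DERIV_imp_deriv)
  qed
  have "((\<lambda>t. u (t *\<^sub>R x)) has_derivative (\<lambda>t. f' (t *\<^sub>R x))) (at 1)"
    by (rule has_derivative_compose[where g = u])
       (use f' in \<open>auto intro!: derivative_eq_intros\<close>)
  then have "((\<lambda>t. u (t *\<^sub>R x)) has_real_derivative f' x) (at 1)"
    by (rule has_derivative_imp_has_field_derivative) (simp add: linear_cmul[OF lin])
  also have "f' x = f' (\<Sum>i\<in>UNIV. (x $ i) *\<^sub>R axis i 1)"
    using basis_expansion[of x] by (simp add: scalar_mult_eq_scaleR)
  also have "\<dots> = euler_op u x"
    by (simp add: linear_sum[OF lin] linear_cmul[OF lin] partial euler_op_def)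
  finally show ?thesis .
qed

text \<open>The factor \<open>\<alpha> \<bullet> x\<close> that comes from pairing \<open>\<alpha>\<close> with \<open>x\<close> cancels the singular denominator.
  On the hyperplane \<open>\<alpha> \<bullet> x = 0\<close> the identity survives because \<open>\<sigma>\<^sub>\<alpha> x = x\<close> there, so no null set
  has to be removed.\<close>

lemma inner_dunkl_grad:
  "x \<bullet> dunkl_grad Rp k u x = euler_op u x + (\<Sum>\<alpha>\<in>Rp. k \<alpha> * (u x - u (reflection \<alpha> x)))"
proof -
  let ?D = "\<lambda>\<alpha>. (u x - u (reflection \<alpha> x)) / (\<alpha> \<bullet> x)"
  have cancel: "(\<alpha> \<bullet> x) * ?D \<alpha> = u x - u (reflection \<alpha> x)" for \<alpha>
    by (cases "\<alpha> \<bullet> x = 0") (simp_all add: reflection_def)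
  have "x \<bullet> dunkl_grad Rp k u x
      = euler_op u x + (\<Sum>i\<in>UNIV. \<Sum>\<alpha>\<in>Rp. x $ i * (k \<alpha> * (\<alpha> $ i) * ?D \<alpha>))"
    by (simp add: inner_vec_def dunkl_grad_def dunkl_op_def euler_op_def distrib_left
        sum.distrib sum_distrib_left)
  also have "(\<Sum>i\<in>UNIV. \<Sum>\<alpha>\<in>Rp. x $ i * (k \<alpha> * (\<alpha> $ i) * ?D \<alpha>))
      = (\<Sum>\<alpha>\<in>Rp. \<Sum>i\<in>UNIV. x $ i * (k \<alpha> * (\<alpha> $ i) * ?D \<alpha>))"
    by (rule sum.swap)
  also have "\<dots> = (\<Sum>\<alpha>\<in>Rp. k \<alpha> * ((\<alpha> \<bullet> x) * ?D \<alpha>))"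
  proof (rule sum.cong[OF refl])
    fix \<alpha>
    have "(\<Sum>i\<in>UNIV. x $ i * (k \<alpha> * (\<alpha> $ i) * ?D \<alpha>)) = (\<Sum>i\<in>UNIV. (\<alpha> $ i * x $ i) * (k \<alpha> * ?D \<alpha>))"
      by (intro sum.cong) (simp_all only: mult_ac)
    also have "\<dots> = (\<alpha> \<bullet> x) * (k \<alpha> * ?D \<alpha>)"
      by (simp only: inner_vec_def inner_real_def sum_distrib_right)
    finally show "(\<Sum>i\<in>UNIV. x $ i * (k \<alpha> * (\<alpha> $ i) * ?D \<alpha>)) = k \<alpha> * ((\<alpha> \<bullet> x) * ?D \<alpha>)"
      by (simp only: mult_ac)
  qed
  finally show ?thesis by (simp only: cancel)
qed

section \<open>The Hardy inequality outside a ball\<close>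

text \<open>The vector field \<open>hardy_flux r p x *\<^sub>R x\<close> is \<open>\<delta>\<^sup>1\<^sup>-\<^sup>p\<close> times the outer unit radial vector, with
  \<open>\<delta> = |x| - r\<close>. Up to a constant factor it is the field \<open>|\<nabla>f|\<^sup>p\<^sup>-\<^sup>2 \<nabla>f / f\<^sup>p\<^sup>-\<^sup>1\<close> of every positive power
  \<open>f\<close> of \<open>\<delta>\<close>.\<close>

definition hardy_flux :: "real \<Rightarrow> real \<Rightarrow> 'a::real_normed_vector \<Rightarrow> real" where
  "hardy_flux r p x = (norm x - r) powr (1 - p) / norm x"

lemma hardy_flux_nonneg: "0 \<le> hardy_flux r p x"
  by (simp add: hardy_flux_def)

lemma borel_measurable_hardy_flux [measurable]:
  "hardy_flux r p \<in> borel_measurable (borel :: 'a::euclidean_space measure)"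
  unfolding hardy_flux_def by measurable

lemma continuous_on_hardy_flux:
  assumes "\<And>x. x \<in> A \<Longrightarrow> r < norm x" "0 \<le> r"
  shows "continuous_on A (hardy_flux r p)"
  unfolding hardy_flux_def using assms by (intro continuous_intros) force+

text \<open>This is where \<open>\<delta> \<le> |x|\<close> enters, for \<open>\<delta> = |x| - r\<close>. It makes the part of the divergence that
  comes from the spreading of the radial field comparable to \<open>\<delta>\<^sup>-\<^sup>p\<close>.\<close>

lemma hardy_flux_le:
  assumes "r < norm x" "0 \<le> r"
  shows "hardy_flux r p x \<le> 1 / (norm x - r) powr p"
proof -
  have "hardy_flux r p x = (norm x - r) / norm x * (1 / (norm x - r) powr p)"
    using assms by (simp add: hardy_flux_def powr_diff)
  also have "\<dots> \<le> 1 * (1 / (norm x - r) powr p)"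
  proof (rule mult_right_mono)
    have "0 < norm x" using assms by linarith
    then show "(norm x - r) / norm x \<le> 1" using assms by simp
  qed simp
  finally show ?thesis by simp
qed

lemma DERIV_hardy_flux_dilation:
  assumes "r < norm x" "0 \<le> r"
  shows "((\<lambda>t. hardy_flux r p (t *\<^sub>R x)) has_real_derivative
    (1 - p) * (1 / (norm x - r) powr p) - hardy_flux r p x) (at 1)"
proof -
  have s: "norm x > 0" "norm x - r > 0" using assms by linarith+
  have "((\<lambda>t. (t * norm x - r) powr (1 - p) / (t * norm x)) has_real_derivative
      (1 - p) * (1 / (norm x - r) powr p) - hardy_flux r p x) (at 1)"
  proof -
    have "((\<lambda>t. t * norm x - r) has_real_derivative norm x) (at 1)"
      by (auto intro!: derivative_eq_intros)
    from DERIV_fun_powr[OF this, of "1 - p"] s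
    have num: "((\<lambda>t. (t * norm x - r) powr (1 - p)) has_real_derivative
        (1 - p) * (norm x - r) powr (- p) * norm x) (at 1)" by simp
    have den: "((\<lambda>t. t * norm x) has_real_derivative norm x) (at 1)"
      by (auto intro!: derivative_eq_intros)
    show ?thesis
      by (rule DERIV_cong[OF DERIV_divide[OF num den]])
         (use s in \<open>simp_all add: hardy_flux_def powr_minus_divide diff_divide_distrib\<close>)
  qed
  then show ?thesis
    by (rule has_field_derivative_transform_within_open[where S = "{0<..}"])
       (auto simp: hardy_flux_def)
qed

text \<open>Integration by parts for \<open>v = \<phi> |u|\<^sup>p\<close> with \<open>\<phi> = hardy_flux r p\<close> and \<open>\<delta> = |x| - r\<close>. As
  \<open>x \<bullet> \<nabla>\<phi> = (1 - p) \<delta>\<^sup>-\<^sup>p - \<phi>\<close>, the zeroth order terms add up to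
  \<open>((p - 1) \<delta>\<^sup>-\<^sup>p - (d - 1) \<phi>) |u|\<^sup>p\<close>, and \<open>\<phi> \<le> \<delta>\<^sup>-\<^sup>p\<close> together with \<open>d \<ge> 1\<close> bounds them from below.\<close>

lemma hardy_flux_inequality:
  fixes u :: "real ^ 'n \<Rightarrow> real"
  assumes sets: "sets M = sets borel" and fin: "\<And>K. compact K \<Longrightarrow> emeasure M K < \<infinity>"
    and hom: "\<And>t (f :: real ^ 'n \<Rightarrow> real). 0 < t \<Longrightarrow> f \<in> borel_measurable borel \<Longrightarrow>
       (\<integral>x. f (t *\<^sub>R x) \<partial>M) = t powr (- d) * (\<integral>x. f x \<partial>M)"
    and d: "1 \<le> d" and p: "1 < p" and r: "0 \<le> r"
    and K: "compact K" "K \<subseteq> exterior_ball r"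
    and off: "\<And>x. x \<notin> K \<Longrightarrow> u x = 0"
    and diff: "\<And>x. u differentiable (at x)"
    and part: "\<And>i. continuous_on UNIV (partial i u)"
  shows "(p - d) * (\<integral>x. \<bar>u x\<bar> powr p / (norm x - r) powr p \<partial>M)
    \<le> p * (\<integral>x. hardy_flux r p x * (spow (u x) (p - 1) * euler_op u x) \<partial>M)"
proof -
  have K_ext: "r < norm x" if "x \<in> K" for x using K that by (auto simp: exterior_ball_def)
  have u_cont: "continuous_on A u" for A
    using diff by (simp add: differentiable_imp_continuous_within continuous_at_imp_continuous_on)
  have euler_cont: "continuous_on A (euler_op u)" for A
    unfolding euler_op_def
    by (intro continuous_intros continuous_on_subset[OF part]) auto
  define a where "a x = \<bar>u x\<bar> powr p / (norm x - r) powr p" for x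
  define v where "v x = hardy_flux r p x * \<bar>u x\<bar> powr p" for x
  define e where "e x = hardy_flux r p x * (spow (u x) (p - 1) * euler_op u x)" for x
  have pow_cont: "continuous_on K (\<lambda>x. \<bar>u x\<bar> powr p)"
    using p by (intro continuous_on_powr' continuous_intros u_cont) auto
  have a_cont: "continuous_on K a"
    unfolding a_def by (intro continuous_intros pow_cont) (use K_ext in force)+
  have v_cont: "continuous_on K v"
    unfolding v_def by (intro continuous_intros pow_cont continuous_on_hardy_flux K_ext r)
  have e_cont: "continuous_on K e"
    unfolding e_def using p
    by (intro continuous_intros continuous_on_hardy_flux K_ext r u_cont euler_cont) auto
  have a_off: "a x = 0" and v_off: "v x = 0" and e_off: "e x = 0" if "x \<notin> K" for x
    using off[OF that] by (auto simp: a_def v_def e_def)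
  note int = integrable_vanishing_off_compact[OF sets fin K(1)]
  have a_int: "integrable M a" and v_int: "integrable M v" and e_int: "integrable M e"
    using int a_cont v_cont e_cont a_off v_off e_off by blast+
  have "((\<lambda>t. v (t *\<^sub>R x)) has_real_derivative p * e x + (1 - p) * a x - v x) (at 1)" for x
  proof (cases "x \<in> K")
    case True
    have "((\<lambda>t. \<bar>u (t *\<^sub>R x)\<bar> powr p) has_real_derivative
        p * spow (u x) (p - 1) * euler_op u x) (at 1)"
      using DERIV_chain2[where f = "\<lambda>s. \<bar>s\<bar> powr p" and g = "\<lambda>t. u (t *\<^sub>R x)" and x = 1,
          OF _ DERIV_dilation[OF diff]] DERIV_abs_powr[OF p, of "u x"] by simp
    from DERIV_mult[OF DERIV_hardy_flux_dilation[OF K_ext[OF True] r, of p] this]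
    show ?thesis
      unfolding v_def by (rule DERIV_cong) (simp add: a_def e_def algebra_simps)
  next
    case False
    \<comment> \<open>Off \<open>K\<close> the flux may be singular, but \<open>v\<close> vanishes along the ray through \<open>x\<close> near \<open>x\<close>.\<close>
    have "open ((\<lambda>t. t *\<^sub>R x) -` (- K))"
      using compact_imp_closed[OF K(1)] by (intro continuous_open_vimage) (auto intro!: continuous_intros)
    then have "((\<lambda>t. v (t *\<^sub>R x)) has_real_derivative 0) (at 1)"
      by (rule has_field_derivative_transform_within_open[rotated])
         (use False v_off in \<open>auto\<close>)
    then show ?thesis using False by (simp add: a_off e_off v_off)
  qed
  moreover have "continuous_on K (\<lambda>x. p * e x + (1 - p) * a x - v x)"
    by (intro continuous_intros a_cont v_cont e_cont)
  ultimately have "(\<integral>x. p * e x + (1 - p) * a x - v x \<partial>M) = - d * (\<integral>x. v x \<partial>M)"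
    by (intro integral_dilation_derivative[OF sets fin hom K(1) v_cont])
       (simp_all add: a_off v_off e_off)
  then have eq: "p * (\<integral>x. e x \<partial>M) = (p - 1) * (\<integral>x. a x \<partial>M) - (d - 1) * (\<integral>x. v x \<partial>M)"
    using a_int v_int e_int by (simp add: algebra_simps)
  have "v x \<le> a x" for x
  proof (cases "x \<in> K")
    case True
    then show ?thesis
      using mult_right_mono[OF hardy_flux_le[OF K_ext[OF True] r, of p], of "\<bar>u x\<bar> powr p"]
      by (simp add: v_def a_def)
  qed (simp add: a_off v_off)
  then have "(d - 1) * (\<integral>x. v x \<partial>M) \<le> (d - 1) * (\<integral>x. a x \<partial>M)"
    using v_int a_int d by (intro mult_left_mono integral_mono) auto
  then show ?thesis
    using eq by (simp add: a_def e_def algebra_simps)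
qed

lemma test_function_on_C1:
  assumes "test_function_on \<Omega> u"
  shows "u differentiable (at x)" "continuous_on UNIV (partial i u)"
proof -
  have "times_cont_diff (Suc 0) u" using assms by (simp only: test_function_on_def)
  then show "u differentiable (at x)" "continuous_on UNIV (partial i u)" by simp_all
qed

lemma ennreal_integral_le_nn_integral:
  fixes f :: "'a \<Rightarrow> real"
  assumes "integrable M f"
  shows "ennreal (\<integral>x. f x \<partial>M) \<le> (\<integral>\<^sup>+x. ennreal (f x) \<partial>M)"
proof -
  have int: "integrable M (\<lambda>x. max 0 (f x))" using assms by simp
  have "ennreal (\<integral>x. f x \<partial>M) \<le> ennreal (\<integral>x. max 0 (f x) \<partial>M)"
    using assms int by (intro ennreal_leI integral_mono) auto
  also have "\<dots> = (\<integral>\<^sup>+x. ennreal (max 0 (f x)) \<partial>M)"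
    by (rule nn_integral_eq_integral[OF int, symmetric]) simp
  also have "\<dots> = (\<integral>\<^sup>+x. ennreal (f x) \<partial>M)"
    by (intro nn_integral_cong) (simp add: max_def ennreal_neg)
  finally show ?thesis .
qed

text \<open>Cauchy-Schwarz reduces the left-hand side to the numbers \<open>a = |s| / (|x| - r)\<close> and \<open>|G|\<close>, for which
  it is Young's inequality for \<open>a\<close> and \<open>|G| / c\<close>. If the term with \<open>x \<bullet> G\<close> integrates to at
  least \<open>p - d\<close> times the Hardy integral, the constant obtained is
  \<open>c\<^sup>p\<^sup>-\<^sup>1 (p - d - c (p - 1))\<close>. It is largest for \<open>p c = p - d\<close>, where it equals \<open>c\<^sup>p\<close>.\<close>

lemma hardy_flux_Young:
  fixes x G :: "'a::real_inner"
  assumes p: "1 < p" and c: "0 < c" and x: "r < norm x" "0 \<le> r"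
  shows "c powr (p - 1) * (p * (hardy_flux r p x * (spow s (p - 1) * (x \<bullet> G)))
      - c * (p - 1) * (\<bar>s\<bar> powr p / (norm x - r) powr p)) \<le> norm G powr p"
proof -
  define a where "a = \<bar>s\<bar> / (norm x - r)"
  have nx: "norm x > 0" "norm x - r > 0" using x by linarith+
  have a0: "0 \<le> a" using nx by (simp add: a_def)
  have ap: "a powr p = \<bar>s\<bar> powr p / (norm x - r) powr p"
    using nx by (simp add: a_def powr_divide)
  have "hardy_flux r p x * (spow s (p - 1) * (x \<bullet> G))
      \<le> hardy_flux r p x * (\<bar>s\<bar> powr (p - 1) * (norm x * norm G))"
  proof (rule mult_left_mono[OF _ hardy_flux_nonneg])
    have "spow s (p - 1) * (x \<bullet> G) \<le> \<bar>spow s (p - 1)\<bar> * \<bar>x \<bullet> G\<bar>"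
      by (metis abs_ge_self abs_mult)
    also have "\<dots> \<le> \<bar>s\<bar> powr (p - 1) * (norm x * norm G)"
      unfolding abs_spow by (intro mult_left_mono Cauchy_Schwarz_ineq2) simp
    finally show "spow s (p - 1) * (x \<bullet> G) \<le> \<bar>s\<bar> powr (p - 1) * (norm x * norm G)" .
  qed
  also have "\<dots> = a powr (p - 1) * norm G"
  proof -
    have "(norm x - r) powr (1 - p) = 1 / (norm x - r) powr (p - 1)"
      using powr_minus_divide[of "norm x - r" "p - 1"] by simp
    then show ?thesis using nx by (simp add: hardy_flux_def a_def powr_divide)
  qed
  finally have 1: "c powr (p - 1) * (p * (hardy_flux r p x * (spow s (p - 1) * (x \<bullet> G))))
      \<le> c powr (p - 1) * (p * (a powr (p - 1) * norm G))"
    using p by (intro mult_left_mono) auto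
  have cp: "c powr p = c powr (p - 1) * c" using c by (simp add: powr_diff)
  have "c powr p * (p * (a powr (p - 1) * (norm G / c)))
      \<le> c powr p * ((p - 1) * a powr p + (norm G / c) powr p)"
    using a0 c p by (intro mult_left_mono Young_powr) auto
  also have "\<dots> = c powr (p - 1) * (c * (p - 1) * a powr p) + norm G powr p"
    using c by (simp add: powr_divide distrib_left) (simp add: cp)
  finally have "c powr (p - 1) * (p * (a powr (p - 1) * norm G))
      \<le> c powr (p - 1) * (c * (p - 1) * a powr p) + norm G powr p"
    using c by (simp add: cp mult_ac)
  with 1 show ?thesis by (simp add: ap right_diff_distrib)
qed

theorem corollary3p9:
  fixes R Rp :: "(real ^ 'n) set"
    and k u :: "real ^ 'n \<Rightarrow> real"
    and r p :: real
  assumes "root_system R" and "normalized_roots R"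
    and "positive_subsystem R Rp"
    and "multiplicity_function R k"
    and "r > 0"
    and "p > real CARD('n) + 2 * dunkl_gamma Rp k"
    and "test_function_on (exterior_ball r) u"
  shows "(\<integral>\<^sup>+x\<in>exterior_ball r. ennreal (norm (dunkl_grad Rp k u x) powr p) \<partial>dunkl_measure Rp k)
    \<ge> ennreal (((p - real CARD('n) - 2 * dunkl_gamma Rp k) / p) powr p) *
      (\<integral>\<^sup>+x\<in>exterior_ball r.
        ennreal (\<bar>u x\<bar> powr p / boundary_dist (exterior_ball r) x powr p) \<partial>dunkl_measure Rp k)"
proof -
  note R = assms(1) and Rp = assms(3) and k = assms(4) and r = assms(5) and u = assms(7)
  define M where "M = dunkl_measure Rp k"
  define d where "d = real CARD('n) + 2 * dunkl_gamma Rp k"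
  define c where "c = (p - d) / p"
  define K where "K = closure {x. u x \<noteq> 0}"
  let ?\<phi> = "hardy_flux r p :: real ^ 'n \<Rightarrow> real"
  have k0: "0 \<le> k \<alpha>" if "\<alpha> \<in> Rp" for \<alpha>
    using k Rp that by (auto simp: multiplicity_function_def positive_subsystem_def)
  then have "0 \<le> dunkl_gamma Rp k" unfolding dunkl_gamma_def by (rule sum_nonneg)
  moreover have "1 \<le> real CARD('n)" by (simp add: Suc_leI)
  ultimately have d: "1 \<le> d" unfolding d_def by linarith
  have pd: "d < p" using assms(6) by (simp add: d_def)
  have p: "1 < p" using d pd by linarith
  have c: "0 < c" "p * c = p - d" using pd p by (auto simp: c_def)
  have sets: "sets M = sets borel" unfolding M_def by (rule sets_dunkl_measure)
  note [measurable_cong] = sets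
  have fin: "emeasure M A < \<infinity>" if "compact A" for A
    unfolding M_def using k0 that by (rule dunkl_measure_compact_finite)
  have hom: "(\<integral>x. f (t *\<^sub>R x) \<partial>M) = t powr (- d) * (\<integral>x. f x \<partial>M)"
    if "0 < t" "f \<in> borel_measurable borel" for t and f :: "real ^ 'n \<Rightarrow> real"
    unfolding M_def d_def using that by (rule integral_dunkl_measure_dilation)
  have K: "compact K" "K \<subseteq> exterior_ball r" using u by (auto simp: test_function_on_def K_def)
  have K_ext: "r < norm x" if "x \<in> K" for x using K that by (auto simp: exterior_ball_def)
  have off: "u x = 0" if "x \<notin> K" for x 
    using that closure_subset[of "{x. u x \<noteq> 0}"] by (auto simp: K_def)
  note diff = test_function_on_C1(1)[OF u] and part = test_function_on_C1(2)[OF u]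
  have u_cont: "continuous_on A u" for A
    using diff by (simp add: differentiable_imp_continuous_within continuous_at_imp_continuous_on)
  have u_meas: "u \<in> borel_measurable borel" by (rule borel_measurable_continuous_onI[OF u_cont])
  have euler_cont: "continuous_on A (euler_op u)" for A
    unfolding euler_op_def
    by (intro continuous_intros continuous_on_subset[OF part]) auto
  have pow_cont: "continuous_on K (\<lambda>x. \<bar>u x\<bar> powr p)"
    using p by (intro continuous_on_powr' continuous_intros u_cont) auto
  note int = integrable_vanishing_off_compact[OF sets fin K(1)]

  define a where "a x = \<bar>u x\<bar> powr p / (norm x - r) powr p" for x
  define e where "e x = ?\<phi> x * (spow (u x) (p - 1) * euler_op u x)" for x
  define b where "b \<alpha> x = ?\<phi> x * (spow (u x) (p - 1) * (u x - u (reflection \<alpha> x)))" for \<alpha> x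
  \<comment> \<open>An integrable minorant of \<open>|\<nabla>\<^sub>k u|\<^sup>p\<close>: it contains the Dunkl gradient only through
    \<open>x \<bullet> \<nabla>\<^sub>k u\<close>, so integrability of the gradient itself is never required.\<close>
  define h where "h x = c powr (p - 1) * (p * (e x + (\<Sum>\<alpha>\<in>Rp. k \<alpha> * b \<alpha> x)) - c * (p - 1) * a x)" for x
  have a_int: "integrable M a"
    unfolding a_def by (rule int) (auto intro!: continuous_intros pow_cont simp: off dest: K_ext)
  have e_int: "integrable M e"
    unfolding e_def using p r
    by (intro int continuous_intros continuous_on_hardy_flux K_ext u_cont euler_cont) (auto simp: off)
  have b_int: "integrable M (b \<alpha>)" and b_nonneg: "0 \<le> (\<integral>x. b \<alpha> x \<partial>M)" if "\<alpha> \<in> Rp" for \<alpha>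
  proof -
    have \<alpha>: "\<alpha> \<in> R" using that Rp by (auto simp: positive_subsystem_def)
    have flux_int: "integrable M (\<lambda>x. ?\<phi> x * \<bar>u x\<bar> powr p)"
      using r p by (intro int continuous_intros continuous_on_hardy_flux K_ext pow_cont) (auto simp: off)
    have refl: "distr M borel (reflection \<alpha>) = M"
      unfolding M_def by (rule distr_dunkl_measure_reflection[OF R Rp k \<alpha>])
    have flux_refl: "?\<phi> (reflection \<alpha> x) = ?\<phi> x" for x
      by (simp add: hardy_flux_def norm_reflection)
    note nonneg = integral_spow_difference_nonneg[OF p sets borel_measurable_reflection refl
        borel_measurable_hardy_flux hardy_flux_nonneg flux_refl u_meas flux_int]
    show "integrable M (b \<alpha>)" unfolding b_def by (rule nonneg(1))
    show "0 \<le> (\<integral>x. b \<alpha> x \<partial>M)" unfolding b_def by (rule nonneg(2))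
  qed
  have sum_int: "integrable M (\<lambda>x. \<Sum>\<alpha>\<in>Rp. k \<alpha> * b \<alpha> x)" using b_int by auto
  have h_int: "integrable M h" unfolding h_def using a_int e_int sum_int by auto

  have "c powr p * (\<integral>x. a x \<partial>M) = c powr (p - 1) * ((p - d) * (\<integral>x. a x \<partial>M) - c * (p - 1) * (\<integral>x. a x \<partial>M))"
  proof -
    have "c powr p = c powr (p - 1) * c" using c by (simp add: powr_diff)
    then show ?thesis unfolding c(2)[symmetric] by (simp add: algebra_simps)
  qed
  also have "\<dots> \<le> c powr (p - 1) * (p * ((\<integral>x. e x \<partial>M) + (\<Sum>\<alpha>\<in>Rp. k \<alpha> * (\<integral>x. b \<alpha> x \<partial>M)))
      - c * (p - 1) * (\<integral>x. a x \<partial>M))"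
  proof -
    have "(p - d) * (\<integral>x. a x \<partial>M) \<le> p * (\<integral>x. e x \<partial>M)"
      unfolding a_def e_def
      by (rule hardy_flux_inequality[OF sets fin hom d p less_imp_le[OF r] K off diff part])
    moreover have "0 \<le> p * (\<Sum>\<alpha>\<in>Rp. k \<alpha> * (\<integral>x. b \<alpha> x \<partial>M))"
      using k0 b_nonneg p by (simp add: sum_nonneg)
    ultimately have "(p - d) * (\<integral>x. a x \<partial>M)
        \<le> p * ((\<integral>x. e x \<partial>M) + (\<Sum>\<alpha>\<in>Rp. k \<alpha> * (\<integral>x. b \<alpha> x \<partial>M)))"
      unfolding distrib_left by linarith
    then show ?thesis by (intro mult_left_mono diff_right_mono) auto
  qed
  also have "\<dots> = (\<integral>x. h x \<partial>M)"
    unfolding h_def using a_int e_int sum_int b_int by (simp add: Bochner_Integration.integral_sum)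
  finally have main: "c powr p * (\<integral>x. a x \<partial>M) \<le> (\<integral>x. h x \<partial>M)" .

  have h_le: "h x \<le> norm (dunkl_grad Rp k u x) powr p" if "x \<in> exterior_ball r" for x
  proof -
    have "e x + (\<Sum>\<alpha>\<in>Rp. k \<alpha> * b \<alpha> x)
        = ?\<phi> x * (spow (u x) (p - 1) * (x \<bullet> dunkl_grad Rp k u x))"
      by (simp add: inner_dunkl_grad e_def b_def distrib_left sum_distrib_left mult_ac)
    then show ?thesis
      using hardy_flux_Young[OF p c(1), of r x] that r by (simp add: h_def a_def exterior_ball_def)
  qed
  have zero_off: "a x = 0" "h x = 0" if "x \<notin> exterior_ball r" for x
  proof -
    have "u x = 0" using K(2) that by (intro off) blast
    then show "a x = 0" "h x = 0" by (simp_all add: h_def a_def e_def b_def)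
  qed

  have "(\<integral>\<^sup>+x\<in>exterior_ball r. ennreal (\<bar>u x\<bar> powr p / boundary_dist (exterior_ball r) x powr p) \<partial>M)
      = (\<integral>\<^sup>+x. ennreal (a x) \<partial>M)"
    by (intro nn_integral_cong)
       (auto simp: indicator_def boundary_dist_exterior_ball[OF r] a_def zero_off(1)[unfolded a_def])
  also have "\<dots> = ennreal (\<integral>x. a x \<partial>M)"
    by (rule nn_integral_eq_integral[OF a_int]) (simp add: a_def)
  finally have "ennreal (c powr p) * (\<integral>\<^sup>+x\<in>exterior_ball r.
        ennreal (\<bar>u x\<bar> powr p / boundary_dist (exterior_ball r) x powr p) \<partial>M)
      = ennreal (c powr p * (\<integral>x. a x \<partial>M))"
    by (simp add: ennreal_mult a_def integral_nonneg)
  also have "\<dots> \<le> ennreal (\<integral>x. h x \<partial>M)" by (rule ennreal_leI[OF main])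
  also have "\<dots> \<le> (\<integral>\<^sup>+x. ennreal (h x) \<partial>M)" by (rule ennreal_integral_le_nn_integral[OF h_int])
  also have "\<dots> \<le> (\<integral>\<^sup>+x\<in>exterior_ball r. ennreal (norm (dunkl_grad Rp k u x) powr p) \<partial>M)"
    using h_le zero_off(2) by (intro nn_integral_mono) (auto simp: indicator_def intro!: ennreal_leI)
  finally show ?thesis by (simp add: M_def c_def d_def diff_diff_eq)
qed

end
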